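(* Let $\mathcal{F}$ be a smooth manifold (the space of field configurations), let $\mathcal{G}$ be a group acting smoothly on $\mathcal{F}$, with $G \in \mathcal{G}$ acting by $\phi \mapsto \phi' = \rho_G(\phi)$, and let $p_t$ be a time-dependent, strictly positive and differentiable probability density on $\mathcal{F}$. If $p_t$ is $\mathcal{G}$-invariant, i.e. $p_t(\rho_G(\phi)) = p_t(\phi)$ for all $\phi \in \mathcal{F}$ and all $G \in \mathcal{G}$, then the score function transforms under the group action as follows: for every $G \in \mathcal{G}$, every $\phi \in \mathcal{F}$ and every time $t$, with $\phi' = \rho_G(\phi)$, $$\boldsymbol{s}'(\phi', t) = \left(D_\phi \rho_G\right)^{-\top} \boldsymbol{s}(\phi, t),$$ where $\boldsymbol{s}(\phi,t) = \nabla_\phi \log p_t(\phi) \in T^*_\phi\mathcal{F}$ is the score function at $\phi$, $\boldsymbol{s}'(\phi',t) = \nabla_{\phi'} \log p_t(\phi') \in T^*_{\phi'}\mathcal{F}$ is the score function at the transformed point $\phi'$, and the Jacobian (differential) $D_\phi \rho_G := \partial \rho_G(\phi)/\partial \phi$ is the linearization of the group action at $\phi$.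
   Context: A smooth action means that $\rho_{e} = \mathrm{id}$ for the identity $e$, $\rho_{GH} = \rho_G \circ \rho_H$ for all $G,H \in \mathcal{G}$, and each $\rho_G : \mathcal{F} \to \mathcal{F}$ is smooth (so each $\rho_G$ is a diffeomorphism of $\mathcal{F}$). Score function: given a time-dependent probability density $p_t(\phi)$ on $\mathcal{F}$, regarded as a real-valued function on $\mathcal{F}$, the score function at time $t$ is the gradient of the log-density, $\boldsymbol{s}(\phi,t) := \nabla_\phi \log p_t(\phi) \in T^*_\phi \mathcal{F}$, where $T^*_\phi\mathcal{F}$ is the cotangent space at $\phi$; that is, $\nabla_\phi \log p_t(\phi)$ denotes the differential of $\log p_t$ at $\phi$ (in coordinates, the column vector of partial derivatives). The differential $D_\phi\rho_G : T_\phi\mathcal{F} \to T_{\phi'}\mathcal{F}$ is a linear isomorphism. The symbol $(D_\phi\rho_G)^{-\top}$ denotes the inverse of its transpose (dual map), a linear map $T^*_\phi\mathcal{F} \to T^*_{\phi'}\mathcal{F}$; in coordinates it is the inverse transpose of the Jacobian matrix. For $\mathcal{F}=\mathbb{R}^n$ all of these are the usual gradients and Jacobian matrices. *)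

theory Defs
  imports "HOL-Analysis.Analysis" "HOL-Algebra.Group"
begin

section \<open>Smooth manifolds\<close>

text \<open>
  \<open>C_on k S f\<close>: \<open>f\<close> is \<open>k\<close> times continuously differentiable on \<open>S\<close>. It is only used for open \<open>S\<close>
  in a finite-dimensional space, where iterated directional derivatives suffice.
\<close>

primrec C_on :: "nat \<Rightarrow> 'e::real_normed_vector set \<Rightarrow> ('e \<Rightarrow> 'f::real_normed_vector) \<Rightarrow> bool" where
  "C_on 0 S f = continuous_on S f"
| "C_on (Suc k) S f =
    ((\<forall>x\<in>S. f differentiable (at x)) \<and>
     (\<forall>v. C_on k S (\<lambda>x. frechet_derivative f (at x) v)))"

definition smooth_on :: "'e::real_normed_vector set \<Rightarrow> ('e \<Rightarrow> 'f::real_normed_vector) \<Rightarrow> bool" where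
  "smooth_on S f \<longleftrightarrow> (\<forall>k. C_on k S f)"

text \<open>A chart is a domain with a coordinate map, whose values off the domain are irrelevant.\<close>

type_synonym ('a, 'e) chart = "'a set \<times> ('a \<Rightarrow> 'e)"

definition chart_inv :: "('a, 'e) chart \<Rightarrow> 'e \<Rightarrow> 'a" where
  "chart_inv c = inv_into (fst c) (snd c)"

definition is_chart :: "'a topology \<Rightarrow> ('a, 'e::real_normed_vector) chart \<Rightarrow> bool" where
  "is_chart X c \<longleftrightarrow> openin X (fst c) \<and> open (snd c ` fst c) \<and>
     homeomorphic_map (subtopology X (fst c)) (top_of_set (snd c ` fst c)) (snd c)"

text \<open>
  The model space \<open>'e\<close> is any finite-dimensional normed space rather than a \<open>euclidean_space\<close>,
  as the latter has positive dimension. The atlas need not be maximal.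
\<close>

definition smooth_manifold :: "'a topology \<Rightarrow> ('a, 'e::real_normed_vector) chart set \<Rightarrow> bool" where
  "smooth_manifold X A \<longleftrightarrow>
     (\<exists>B::'e set. finite B \<and> span B = UNIV) \<and>
     Hausdorff_space X \<and> second_countable X \<and>
     (\<forall>c\<in>A. is_chart X c) \<and>
     (\<Union>c\<in>A. fst c) = topspace X \<and>
     (\<forall>c\<in>A. \<forall>d\<in>A. smooth_on (snd c ` (fst c \<inter> fst d)) (snd d \<circ> chart_inv c))"

definition smooth_map ::
  "'a topology \<Rightarrow> ('a, 'e::real_normed_vector) chart set \<Rightarrow>
   'b topology \<Rightarrow> ('b, 'f::real_normed_vector) chart set \<Rightarrow> ('a \<Rightarrow> 'b) \<Rightarrow> bool" where
  "smooth_map X A Y B f \<longleftrightarrow> continuous_map X Y f \<and>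
     (\<forall>c\<in>A. \<forall>d\<in>B. smooth_on (snd c ` (fst c \<inter> f -` fst d)) (snd d \<circ> f \<circ> chart_inv c))"

definition charts_at :: "('a, 'e) chart set \<Rightarrow> 'a \<Rightarrow> ('a, 'e) chart set" where
  "charts_at A x = {c \<in> A. x \<in> fst c}"

definition differentiable_fun ::
  "'a topology \<Rightarrow> ('a, 'e::real_normed_vector) chart set \<Rightarrow> ('a \<Rightarrow> real) \<Rightarrow> bool" where
  "differentiable_fun X A f \<longleftrightarrow>
     (\<forall>x\<in>topspace X. \<forall>c\<in>charts_at A x. (f \<circ> chart_inv c) differentiable (at (snd c x)))"

section \<open>Tangent and cotangent spaces\<close>

text \<open>
  A tangent vector at \<open>x\<close> is given by its components \<open>v c\<close> in all charts \<open>c\<close> around \<open>x\<close>, related by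
  the derivatives of the coordinate changes (and set to \<open>0\<close> at the other arguments \<open>c\<close>). The vector
  space structure is pointwise. Derivations on smooth functions are avoided because they cannot be
  applied to functions that are merely differentiable.
\<close>

definition tangent_space ::
  "('a, 'e::real_normed_vector) chart set \<Rightarrow> 'a \<Rightarrow> (('a, 'e) chart \<Rightarrow> 'e) set" where
  "tangent_space A x = {v.
     (\<forall>c\<in>charts_at A x. \<forall>d\<in>charts_at A x.
        v d = frechet_derivative (snd d \<circ> chart_inv c) (at (snd c x)) (v c)) \<and>
     (\<forall>c. c \<notin> charts_at A x \<longrightarrow> v c = 0)}"

definition cotangent_space ::
  "('a, 'e::real_normed_vector) chart set \<Rightarrow> 'a \<Rightarrow> ((('a, 'e) chart \<Rightarrow> 'e) \<Rightarrow> real) set" where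
  "cotangent_space A x = {\<alpha> \<in> extensional (tangent_space A x).
     (\<forall>v\<in>tangent_space A x. \<forall>w\<in>tangent_space A x. \<alpha> (\<lambda>c. v c + w c) = \<alpha> v + \<alpha> w) \<and>
     (\<forall>r. \<forall>v\<in>tangent_space A x. \<alpha> (\<lambda>c. r *\<^sub>R v c) = r * \<alpha> v)}"

text \<open>
  In the next two definitions the chart \<open>c\<close> around \<open>x\<close> is arbitrary: on tangent vectors at \<open>x\<close> the
  result does not depend on it.
\<close>

definition differential ::
  "('a, 'e::real_normed_vector) chart set \<Rightarrow> ('b, 'f::real_normed_vector) chart set \<Rightarrow>
   ('a \<Rightarrow> 'b) \<Rightarrow> 'a \<Rightarrow> (('a, 'e) chart \<Rightarrow> 'e) \<Rightarrow> (('b, 'f) chart \<Rightarrow> 'f)" where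
  "differential A B f x v = (\<lambda>d.
     if d \<in> charts_at B (f x)
     then let c = SOME c. c \<in> charts_at A x
          in frechet_derivative (snd d \<circ> f \<circ> chart_inv c) (at (snd c x)) (v c)
     else 0)"

definition gradient ::
  "('a, 'e::real_normed_vector) chart set \<Rightarrow> ('a \<Rightarrow> real) \<Rightarrow> 'a \<Rightarrow>
   (('a, 'e) chart \<Rightarrow> 'e) \<Rightarrow> real" where
  "gradient A f x = (\<lambda>v\<in>tangent_space A x.
     let c = SOME c. c \<in> charts_at A x
     in frechet_derivative (f \<circ> chart_inv c) (at (snd c x)) (v c))"

text \<open>
  For a linear map \<open>L\<close> from the tangent space at \<open>x\<close> to the one at \<open>y\<close>: its dual map, from the
  cotangent space at \<open>y\<close> to the one at \<open>x\<close>, and the inverse of that dual map when \<open>L\<close> is an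
  isomorphism.
\<close>

definition transpose_map ::
  "('a, 'e::real_normed_vector) chart set \<Rightarrow> 'a \<Rightarrow>
   ((('a, 'e) chart \<Rightarrow> 'e) \<Rightarrow> (('b, 'f) chart \<Rightarrow> 'f)) \<Rightarrow>
   ((('b, 'f) chart \<Rightarrow> 'f) \<Rightarrow> real) \<Rightarrow> (('a, 'e) chart \<Rightarrow> 'e) \<Rightarrow> real" where
  "transpose_map A x L \<beta> = (\<lambda>v\<in>tangent_space A x. \<beta> (L v))"

definition inverse_transpose ::
  "('a, 'e::real_normed_vector) chart set \<Rightarrow> 'a \<Rightarrow>
   ('b, 'f::real_normed_vector) chart set \<Rightarrow> 'b \<Rightarrow>
   ((('a, 'e) chart \<Rightarrow> 'e) \<Rightarrow> (('b, 'f) chart \<Rightarrow> 'f)) \<Rightarrow>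
   ((('a, 'e) chart \<Rightarrow> 'e) \<Rightarrow> real) \<Rightarrow> (('b, 'f) chart \<Rightarrow> 'f) \<Rightarrow> real" where
  "inverse_transpose A x B y L = inv_into (cotangent_space B y) (transpose_map A x L)"

section \<open>Group actions, densities and scores\<close>

definition smooth_action ::
  "('g, 'm) monoid_scheme \<Rightarrow> 'a topology \<Rightarrow> ('a, 'e::real_normed_vector) chart set \<Rightarrow>
   ('g \<Rightarrow> 'a \<Rightarrow> 'a) \<Rightarrow> bool" where
  "smooth_action \<G> X A \<rho> \<longleftrightarrow>
     (\<forall>x\<in>topspace X. \<rho> \<one>\<^bsub>\<G>\<^esub> x = x) \<and>
     (\<forall>g\<in>carrier \<G>. \<forall>h\<in>carrier \<G>. \<forall>x\<in>topspace X. \<rho> (g \<otimes>\<^bsub>\<G>\<^esub> h) x = \<rho> g (\<rho> h x)) \<and>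
     (\<forall>g\<in>carrier \<G>. smooth_map X A X A (\<rho> g))"

definition probability_density :: "'a measure \<Rightarrow> ('a \<Rightarrow> real) \<Rightarrow> bool" where
  "probability_density \<mu> f \<longleftrightarrow> f \<in> borel_measurable \<mu> \<and> (\<forall>x\<in>space \<mu>. 0 \<le> f x) \<and>
     (\<integral>\<^sup>+x. ennreal (f x) \<partial>\<mu>) = 1"

definition score ::
  "('a, 'e::real_normed_vector) chart set \<Rightarrow> (real \<Rightarrow> 'a \<Rightarrow> real) \<Rightarrow> 'a \<Rightarrow> real \<Rightarrow>
   (('a, 'e) chart \<Rightarrow> 'e) \<Rightarrow> real" where
  "score A p x t = gradient A (\<lambda>y. ln (p t y)) x"

end

theory Submission
  imports Defs
begin

text \<open>
  By the chain rule, \<open>f \<circ> \<rho> = f\<close> says that the transpose of \<open>D\<rho>\<close> at \<open>\<phi>\<close> sends the differential of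
  \<open>f\<close> at \<open>\<rho> \<phi>\<close> to the one at \<open>\<phi>\<close>. The transpose is injective because \<open>D\<rho>\<close> has the differential of
  the inverse group element as a right inverse, so its inverse recovers the differential at \<open>\<rho> \<phi>\<close>.
\<close>

section \<open>Charts and their coordinates\<close>

lemma smooth_on_differentiable:
  assumes "smooth_on S f" "x \<in> S"
  shows "f differentiable (at x)"
proof -
  have "C_on (Suc 0) S f"
    using assms(1) unfolding smooth_on_def by blast
  with assms(2) show ?thesis by simp
qed

lemma chart_inv_left:
  assumes "is_chart X c" "x \<in> fst c"
  shows "chart_inv c (snd c x) = x"
proof -
  have "inj_on (snd c) (topspace (subtopology X (fst c)))"
    using assms(1) unfolding is_chart_def by (blast intro: homeomorphic_imp_injective_map)
  moreover have "fst c \<subseteq> topspace X"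
    using assms(1) openin_subset unfolding is_chart_def by blast
  ultimately have "inj_on (snd c) (fst c)"
    by (simp add: Int_absorb1)
  with assms(2) show ?thesis by (simp add: chart_inv_def)
qed

text \<open>A homeomorphism is an open map onto its image, and the image of the whole chart domain
  is open in the model space, so relative openness becomes openness. This supplies the
  neighbourhoods on which coordinate expressions are compared.\<close>

lemma open_chart_image:
  assumes "is_chart X c" "openin X U"
  shows "open (snd c ` (fst c \<inter> U))"
proof -
  have "open_map (subtopology X (fst c)) (top_of_set (snd c ` fst c)) (snd c)"
    using assms(1) unfolding is_chart_def by (blast intro: homeomorphic_imp_open_map)
  moreover have "openin (subtopology X (fst c)) (fst c \<inter> U)"
    using assms(2) by (auto simp: openin_subtopology)
  ultimately have "openin (top_of_set (snd c ` fst c)) (snd c ` (fst c \<inter> U))"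
    unfolding open_map_def by blast
  then show ?thesis
    using assms(1) openin_open_trans unfolding is_chart_def by blast
qed

lemma smooth_manifold_chart:
  assumes "smooth_manifold X A" "c \<in> charts_at A x"
  shows "is_chart X c" "c \<in> A" "x \<in> fst c" "fst c \<subseteq> topspace X"
proof -
  show c: "is_chart X c" "c \<in> A" "x \<in> fst c"
    using assms by (auto simp: smooth_manifold_def charts_at_def)
  show "fst c \<subseteq> topspace X"
    using c(1) openin_subset unfolding is_chart_def by blast
qed

text \<open>Justifies the choice of chart made in \<open>gradient\<close> and
  \<open>differential\<close>: the charts cover the manifold.\<close>

lemma some_chart:
  assumes "smooth_manifold X A" "x \<in> topspace X"
  shows "(SOME c. c \<in> charts_at A x) \<in> charts_at A x"
proof -
  have "x \<in> (\<Union>c\<in>A. fst c)"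
    using assms by (simp add: smooth_manifold_def)
  then have "\<exists>c. c \<in> charts_at A x"
    unfolding charts_at_def by blast
  then show ?thesis by (rule someI_ex)
qed

section \<open>Smooth maps in coordinates and the chain rule\<close>

text \<open>In coordinates the identity is a coordinate change, so this is the compatibility of the
  atlas. It makes changes of chart a special case of the chain rule below.\<close>

lemma smooth_map_id:
  assumes "smooth_manifold X A"
  shows "smooth_map X A X A (\<lambda>x. x)"
  using assms by (simp add: smooth_map_def smooth_manifold_def comp_def)

lemma smooth_map_differentiable:
  assumes "smooth_map X A Y B f" "c \<in> charts_at A x" "d \<in> charts_at B (f x)"
  shows "(snd d \<circ> f \<circ> chart_inv c) differentiable (at (snd c x))"
proof (rule smooth_on_differentiable)
  show "smooth_on (snd c ` (fst c \<inter> f -` fst d)) (snd d \<circ> f \<circ> chart_inv c)"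
    using assms by (simp add: smooth_map_def charts_at_def)
  show "snd c x \<in> snd c ` (fst c \<inter> f -` fst d)"
    using assms(2,3) by (auto simp: charts_at_def)
qed

text \<open>In coordinates \<open>h\<close> factors through \<open>f\<close> and \<open>g\<close>
  near the point, and a derivative depends only on values near the point. \<open>g\<close> may be
  real-valued or a coordinate map, and \<open>h\<close> has to agree with the composite only on the
  manifold. Independence of charts, functoriality and invariance are all instances.\<close>

lemma frechet_derivative_chart_compose:
  assumes X: "smooth_manifold X A" and Y: "smooth_manifold Y B" and f: "smooth_map X A Y B f"
    and c: "c \<in> charts_at A x" and d: "d \<in> charts_at B (f x)"
    and g: "(g \<circ> chart_inv d) differentiable (at (snd d (f x)))"
    and h: "\<And>u. u \<in> topspace X \<Longrightarrow> h u = g (f u)"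
  shows "frechet_derivative (h \<circ> chart_inv c) (at (snd c x)) v =
    frechet_derivative (g \<circ> chart_inv d) (at (snd d (f x)))
      (frechet_derivative (snd d \<circ> f \<circ> chart_inv c) (at (snd c x)) v)"
proof -
  note c' = smooth_manifold_chart[OF X c] and d' = smooth_manifold_chart[OF Y d]
  let ?u = "snd d \<circ> f \<circ> chart_inv c" and ?g = "g \<circ> chart_inv d"
  \<comment> \<open>On this set \<open>chart_inv d\<close> undoes \<open>snd d\<close> at the image
    point, so the factorization is exact there.\<close>
  let ?S = "snd c ` (fst c \<inter> {z \<in> topspace X. f z \<in> fst d})"
  have "openin X {z \<in> topspace X. f z \<in> fst d}"
    using f d'(1) by (auto simp: smooth_map_def is_chart_def intro: openin_continuous_map_preimage)
  then have S: "open ?S"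
    by (rule open_chart_image[OF c'(1)])
  have xS: "snd c x \<in> ?S"
    using c' d'(3) by blast
  have ux: "?u (snd c x) = snd d (f x)"
    by (simp add: chart_inv_left[OF c'(1,3)])
  have "(?u has_derivative frechet_derivative ?u (at (snd c x))) (at (snd c x))"
    using smooth_map_differentiable[OF f c d] by (simp add: frechet_derivative_works)
  moreover have "(?g has_derivative frechet_derivative ?g (at (snd d (f x)))) (at (?u (snd c x)))"
    using g unfolding ux by (simp add: frechet_derivative_works)
  ultimately have "(?g \<circ> ?u has_derivative
      frechet_derivative ?g (at (snd d (f x))) \<circ> frechet_derivative ?u (at (snd c x))) (at (snd c x))"
    by (rule diff_chain_at)
  note this S xS
  moreover have "(?g \<circ> ?u) z = (h \<circ> chart_inv c) z" if "z \<in> ?S" for z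
    using that by (auto simp: chart_inv_left[OF c'(1)] chart_inv_left[OF d'(1)] h)
  ultimately have "(h \<circ> chart_inv c has_derivative
      frechet_derivative ?g (at (snd d (f x))) \<circ> frechet_derivative ?u (at (snd c x))) (at (snd c x))"
    by (rule has_derivative_transform_within_open)
  from frechet_derivative_at[OF this, symmetric] show ?thesis by simp
qed

section \<open>Tangent vectors and their linear structure\<close>

lemma tangent_space_change_chart:
  assumes "v \<in> tangent_space A x" "c \<in> charts_at A x" "d \<in> charts_at A x"
  shows "v d = frechet_derivative (snd d \<circ> chart_inv c) (at (snd c x)) (v c)"
  using assms unfolding tangent_space_def by blast

lemma tangent_space_zero:
  assumes "v \<in> tangent_space A x" "c \<notin> charts_at A x"
  shows "v c = 0"
  using assms unfolding tangent_space_def by blast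

lemma tangent_spaceI:
  assumes "\<And>c d. c \<in> charts_at A x \<Longrightarrow> d \<in> charts_at A x \<Longrightarrow>
      v d = frechet_derivative (snd d \<circ> chart_inv c) (at (snd c x)) (v c)"
    and "\<And>c. c \<notin> charts_at A x \<Longrightarrow> v c = 0"
  shows "v \<in> tangent_space A x"
  using assms unfolding tangent_space_def by blast

lemma chart_transition_linear:
  assumes "smooth_manifold X A" "c \<in> charts_at A x" "d \<in> charts_at A x"
  shows "linear (frechet_derivative (snd d \<circ> chart_inv c) (at (snd c x)))"
  using smooth_map_differentiable[OF smooth_map_id[OF assms(1)] assms(2,3)]
  by (intro linear_frechet_derivative) (simp add: comp_def)

text \<open>The compatibility conditions between components are linear. Closure under sums, and
  under multiples in the next lemma, is what lets linearity of a covector restricted to the tangent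
  space be checked.\<close>

lemma tangent_space_add:
  assumes "smooth_manifold X A" "v \<in> tangent_space A x" "w \<in> tangent_space A x"
  shows "(\<lambda>c. v c + w c) \<in> tangent_space A x"
proof (rule tangent_spaceI)
  fix c d assume cd: "c \<in> charts_at A x" "d \<in> charts_at A x"
  show "v d + w d = frechet_derivative (snd d \<circ> chart_inv c) (at (snd c x)) (v c + w c)"
    by (simp only: linear_add[OF chart_transition_linear[OF assms(1) cd]]
        tangent_space_change_chart[OF assms(2) cd] tangent_space_change_chart[OF assms(3) cd])
qed (simp add: tangent_space_zero[OF assms(2)] tangent_space_zero[OF assms(3)])

lemma tangent_space_scaleR:
  assumes "smooth_manifold X A" "v \<in> tangent_space A x"
  shows "(\<lambda>c. r *\<^sub>R v c) \<in> tangent_space A x"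
proof (rule tangent_spaceI)
  fix c d assume cd: "c \<in> charts_at A x" "d \<in> charts_at A x"
  show "r *\<^sub>R v d = frechet_derivative (snd d \<circ> chart_inv c) (at (snd c x)) (r *\<^sub>R v c)"
    by (simp only: linear_cmul[OF chart_transition_linear[OF assms(1) cd]]
        tangent_space_change_chart[OF assms(2) cd])
qed (simp add: tangent_space_zero[OF assms(2)])

section \<open>Gradients as covectors\<close>

text \<open>Passing from the chosen chart \<open>c0\<close> to \<open>c\<close> changes the
  coordinate expression of \<open>f\<close> by the transition map, whose derivative carries
  \<open>v c0\<close> to \<open>v c\<close>. This is the chain rule for the identity map.\<close>

lemma gradient_eq_chart:
  assumes X: "smooth_manifold X A" and x: "x \<in> topspace X" and f: "differentiable_fun X A f"
    and v: "v \<in> tangent_space A x" and c: "c \<in> charts_at A x"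
  shows "gradient A f x v = frechet_derivative (f \<circ> chart_inv c) (at (snd c x)) (v c)"
proof -
  define c0 where "c0 = (SOME c. c \<in> charts_at A x)"
  have c0: "c0 \<in> charts_at A x"
    unfolding c0_def by (rule some_chart[OF X x])
  have "(f \<circ> chart_inv c) differentiable (at (snd c x))"
    using f x c by (simp add: differentiable_fun_def)
  then have "frechet_derivative (f \<circ> chart_inv c0) (at (snd c0 x)) (v c0) =
      frechet_derivative (f \<circ> chart_inv c) (at (snd c x))
        (frechet_derivative (snd c \<circ> (\<lambda>x. x) \<circ> chart_inv c0) (at (snd c0 x)) (v c0))"
    by (intro frechet_derivative_chart_compose[OF X X smooth_map_id[OF X] c0 c]) auto
  also have "\<dots> = frechet_derivative (f \<circ> chart_inv c) (at (snd c x)) (v c)"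
    using tangent_space_change_chart[OF v c0 c] by (simp add: comp_def)
  finally show ?thesis
    using v by (simp add: gradient_def c0_def Let_def)
qed

lemma gradient_in_cotangent_space:
  assumes X: "smooth_manifold X A" and x: "x \<in> topspace X" and f: "differentiable_fun X A f"
  shows "gradient A f x \<in> cotangent_space A x"
proof -
  define c where "c = (SOME c. c \<in> charts_at A x)"
  have c: "c \<in> charts_at A x"
    unfolding c_def by (rule some_chart[OF X x])
  let ?D = "frechet_derivative (f \<circ> chart_inv c) (at (snd c x))"
  have lin: "linear ?D"
    using f x c by (intro linear_frechet_derivative) (simp add: differentiable_fun_def)
  have D: "gradient A f x v = ?D (v c)" if "v \<in> tangent_space A x" for v
    using gradient_eq_chart[OF X x f that c] .
  show ?thesis
    unfolding cotangent_space_def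
    using tangent_space_add[OF X] tangent_space_scaleR[OF X]
    \<comment> \<open>Linearity is read off in the fixed chart; the remaining goal, extensionality,
      holds because \<open>gradient\<close> is a restriction to the tangent space.\<close>
    by (simp add: D linear_add[OF lin] linear_cmul[OF lin]) (simp add: gradient_def)
qed

section \<open>Differentials of smooth maps\<close>

text \<open>The argument for gradients again, applied to the vector-valued function
  \<open>snd d \<circ> f\<close> in place of a real function.\<close>

lemma differential_eq_chart:
  assumes X: "smooth_manifold X A" and Y: "smooth_manifold Y B" and f: "smooth_map X A Y B f"
    and v: "v \<in> tangent_space A x" and c: "c \<in> charts_at A x" and d: "d \<in> charts_at B (f x)"
  shows "differential A B f x v d =
    frechet_derivative (snd d \<circ> f \<circ> chart_inv c) (at (snd c x)) (v c)"
proof -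
  define c0 where "c0 = (SOME c. c \<in> charts_at A x)"
  have c0: "c0 \<in> charts_at A x"
    unfolding c0_def using c by (rule someI)
  have "frechet_derivative ((snd d \<circ> f) \<circ> chart_inv c0) (at (snd c0 x)) (v c0) =
      frechet_derivative ((snd d \<circ> f) \<circ> chart_inv c) (at (snd c x))
        (frechet_derivative (snd c \<circ> (\<lambda>x. x) \<circ> chart_inv c0) (at (snd c0 x)) (v c0))"
    using smooth_map_differentiable[OF f c d]
    by (intro frechet_derivative_chart_compose[OF X X smooth_map_id[OF X] c0 c]) auto
  also have "\<dots> = frechet_derivative (snd d \<circ> f \<circ> chart_inv c) (at (snd c x)) (v c)"
    using tangent_space_change_chart[OF v c0 c] by (simp add: comp_def)
  finally show ?thesis
    using d by (simp add: differential_def c0_def Let_def)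
qed

lemma chart_transition_differentiable:
  assumes "smooth_manifold X A" "c \<in> charts_at A x" "d \<in> charts_at A x"
  shows "(snd d \<circ> chart_inv c) differentiable (at (snd c x))"
  using smooth_map_differentiable[OF smooth_map_id[OF assms(1)] assms(2,3)] by (simp add: comp_def)

text \<open>The required compatibility of components is the chain rule for \<open>f\<close> followed
  by the coordinate map \<open>snd d'\<close>.\<close>

lemma differential_in_tangent_space:
  assumes X: "smooth_manifold X A" and Y: "smooth_manifold Y B" and f: "smooth_map X A Y B f"
    and x: "x \<in> topspace X" and v: "v \<in> tangent_space A x"
  shows "differential A B f x v \<in> tangent_space B (f x)"
proof -
  obtain c where c: "c \<in> charts_at A x"
    using some_chart[OF X x] by blast
  have "differential A B f x v d' =
      frechet_derivative (snd d' \<circ> chart_inv d) (at (snd d (f x))) (differential A B f x v d)"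
    if d: "d \<in> charts_at B (f x)" and d': "d' \<in> charts_at B (f x)" for d d'
    unfolding differential_eq_chart[OF X Y f v c d] differential_eq_chart[OF X Y f v c d']
    by (rule frechet_derivative_chart_compose[OF X Y f c d chart_transition_differentiable[OF Y d d']])
      simp
  then show ?thesis
    by (rule tangent_spaceI) (simp_all add: differential_def)
qed

text \<open>Functoriality: a right inverse on points gives a right inverse on tangent vectors. This
  yields surjectivity of the differential of a group element.\<close>

lemma differential_inverse:
  assumes X: "smooth_manifold X A" and Y: "smooth_manifold Y B"
    and f: "smooth_map X A Y B f" and g: "smooth_map Y B X A g"
    and fg: "\<And>u. u \<in> topspace Y \<Longrightarrow> f (g u) = u"
    and y: "y \<in> topspace Y" and w: "w \<in> tangent_space B y"
  shows "differential A B f (g y) (differential B A g y w) = w"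
proof
  fix d
  have gy: "g y \<in> topspace X"
    using g y by (auto simp: smooth_map_def dest: continuous_map_image_subset_topspace)
  obtain c where c: "c \<in> charts_at A (g y)"
    using some_chart[OF X gy] by blast
  show "differential A B f (g y) (differential B A g y w) d = w d"
  proof (cases "d \<in> charts_at B y")
    case True
    then have d: "d \<in> charts_at B (f (g y))"
      using fg y by simp
    have "differential A B f (g y) (differential B A g y w) d =
      frechet_derivative ((snd d \<circ> f) \<circ> chart_inv c) (at (snd c (g y)))
        (frechet_derivative (snd c \<circ> g \<circ> chart_inv d) (at (snd d y)) (w d))"
      by (simp only: differential_eq_chart[OF X Y f differential_in_tangent_space[OF Y X g y w] c d]
          differential_eq_chart[OF Y X g w True c])
    \<comment> \<open>The chain rule for \<open>g\<close> followed by
      \<open>snd d \<circ> f\<close>; the composite is \<open>snd d\<close> on the manifold.\<close>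
    also have "\<dots> = frechet_derivative (snd d \<circ> chart_inv d) (at (snd d y)) (w d)"
      using smooth_map_differentiable[OF f c d] fg
      by (intro frechet_derivative_chart_compose[OF Y X g True c, symmetric]) auto
    \<comment> \<open>The compatibility condition of \<open>w\<close> from the chart
      \<open>d\<close> to itself says just this, so the derivative of the identity need not be
      computed.\<close>
    also have "\<dots> = w d"
      using tangent_space_change_chart[OF w True True] by simp
    finally show ?thesis .
  next
    case False
    then show ?thesis
      using tangent_space_zero[OF w] fg y by (simp add: differential_def)
  qed
qed

section \<open>Transposes of differentials\<close>

text \<open>The chain rule in dual form: pulling back the differential of \<open>h\<close> gives the
  differential of \<open>h \<circ> f\<close>. For an invariant function, \<open>k\<close> and
  \<open>h\<close> coincide.\<close>

lemma transpose_differential_gradient: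
  assumes X: "smooth_manifold X A" and Y: "smooth_manifold Y B" and f: "smooth_map X A Y B f"
    and h: "differentiable_fun Y B h" and k: "differentiable_fun X A k"
    and kh: "\<And>u. u \<in> topspace X \<Longrightarrow> k u = h (f u)" and x: "x \<in> topspace X"
  shows "transpose_map A x (differential A B f x) (gradient B h (f x)) = gradient A k x"
proof
  fix v
  have fx: "f x \<in> topspace Y"
    using f x by (auto simp: smooth_map_def dest: continuous_map_image_subset_topspace)
  obtain c where c: "c \<in> charts_at A x"
    using some_chart[OF X x] by blast
  obtain d where d: "d \<in> charts_at B (f x)"
    using some_chart[OF Y fx] by blast
  have hd: "(h \<circ> chart_inv d) differentiable (at (snd d (f x)))"
    using h fx d by (simp add: differentiable_fun_def)
  show "transpose_map A x (differential A B f x) (gradient B h (f x)) v = gradient A k x v"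
  proof (cases "v \<in> tangent_space A x")
    case v: True
    have "gradient B h (f x) (differential A B f x v) =
      frechet_derivative (h \<circ> chart_inv d) (at (snd d (f x)))
        (frechet_derivative (snd d \<circ> f \<circ> chart_inv c) (at (snd c x)) (v c))"
      by (simp only: gradient_eq_chart[OF Y fx h differential_in_tangent_space[OF X Y f x v] d]
          differential_eq_chart[OF X Y f v c d])
    also have "\<dots> = frechet_derivative (k \<circ> chart_inv c) (at (snd c x)) (v c)"
      by (rule frechet_derivative_chart_compose[OF X Y f c d hd kh, symmetric])
    also have "\<dots> = gradient A k x v"
      by (rule gradient_eq_chart[OF X x k v c, symmetric])
    finally show ?thesis
      using v by (simp add: transpose_map_def)
  next
    \<comment> \<open>Off the tangent space both restrictions take the value
      \<open>undefined\<close>.\<close>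
    case False
    then show ?thesis by (simp add: transpose_map_def gradient_def)
  qed
qed

text \<open>The dual of a surjective map is injective: covectors that agree on all
  \<open>L v\<close> agree on the tangent space at \<open>y\<close>, and extensionality fixes their
  values elsewhere.\<close>

lemma inj_on_transpose_map:
  assumes "tangent_space B y \<subseteq> L ` tangent_space A x"
  shows "inj_on (transpose_map A x L) (cotangent_space B y)"
proof (rule inj_onI)
  fix \<alpha> \<beta>
  assume \<alpha>: "\<alpha> \<in> cotangent_space B y" and \<beta>: "\<beta> \<in> cotangent_space B y"
    and eq: "transpose_map A x L \<alpha> = transpose_map A x L \<beta>"
  show "\<alpha> = \<beta>"
  proof (rule extensionalityI)
    show "\<alpha> \<in> extensional (tangent_space B y)" "\<beta> \<in> extensional (tangent_space B y)"
      using \<alpha> \<beta> by (simp_all add: cotangent_space_def)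
    fix w assume "w \<in> tangent_space B y"
    then obtain v where v: "v \<in> tangent_space A x" and w: "w = L v"
      using assms by blast
    show "\<alpha> w = \<beta> w"
      using fun_cong[OF eq, of v] v by (simp add: transpose_map_def w)
  qed
qed

section \<open>The score of an invariant density\<close>

lemma differentiable_fun_ln:
  assumes X: "smooth_manifold X A" and f: "differentiable_fun X A f"
    and pos: "\<And>x. x \<in> topspace X \<Longrightarrow> 0 < f x"
  shows "differentiable_fun X A (\<lambda>x. ln (f x))"
  unfolding differentiable_fun_def
proof (intro ballI)
  fix x c
  assume x: "x \<in> topspace X" and c: "c \<in> charts_at A x"
  let ?u = "f \<circ> chart_inv c"
  have "(?u has_derivative frechet_derivative ?u (at (snd c x))) (at (snd c x))"
    using f x c by (simp add: differentiable_fun_def frechet_derivative_works[symmetric])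
  \<comment> \<open>The coordinate expression takes the value \<open>f x\<close> at this point, so
    positivity on the manifold suffices.\<close>
  moreover have "0 < ?u (snd c x)"
    using pos[OF x] chart_inv_left[OF smooth_manifold_chart(1,3)[OF X c]] by simp
  ultimately have "((\<lambda>z. ln (?u z)) has_derivative
      (\<lambda>v. frechet_derivative ?u (at (snd c x)) v * inverse (?u (snd c x)))) (at (snd c x))"
    by (intro has_derivative_ln)
  then show "((\<lambda>x. ln (f x)) \<circ> chart_inv c) differentiable (at (snd c x))"
    by (auto simp: differentiable_def comp_def)
qed

theorem theoremC4:
  fixes F :: "'a topology" and A :: "('a, 'e::real_normed_vector) chart set"
    and \<G> :: "('g, 'm) monoid_scheme" and \<rho> :: "'g \<Rightarrow> 'a \<Rightarrow> 'a"
    and \<mu> :: "'a measure" and T :: "real set" and p :: "real \<Rightarrow> 'a \<Rightarrow> real"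
  assumes manifold: "smooth_manifold F A"
    and group: "group \<G>"
    and action: "smooth_action \<G> F A \<rho>"
    and reference_measure: "space \<mu> = topspace F" "sets \<mu> = sigma_sets (topspace F) {U. openin F U}"
    and density: "\<And>t. t \<in> T \<Longrightarrow> probability_density \<mu> (p t)"
    and positive: "\<And>t \<phi>. t \<in> T \<Longrightarrow> \<phi> \<in> topspace F \<Longrightarrow> 0 < p t \<phi>"
    and differentiable: "\<And>t. t \<in> T \<Longrightarrow> differentiable_fun F A (p t)"
    and invariant: "\<And>t G \<phi>. t \<in> T \<Longrightarrow> G \<in> carrier \<G> \<Longrightarrow> \<phi> \<in> topspace F \<Longrightarrow> p t (\<rho> G \<phi>) = p t \<phi>"
  shows "\<forall>G\<in>carrier \<G>. \<forall>\<phi>\<in>topspace F. \<forall>t\<in>T.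
    score A p (\<rho> G \<phi>) t =
      inverse_transpose A \<phi> A (\<rho> G \<phi>) (differential A A (\<rho> G) \<phi>) (score A p \<phi> t)"
proof (intro ballI)
  fix G \<phi> t
  assume G: "G \<in> carrier \<G>" and \<phi>: "\<phi> \<in> topspace F" and t: "t \<in> T"
  interpret group \<G> by (rule group)
  let ?H = "inv\<^bsub>\<G>\<^esub> G"
  let ?L = "differential A A (\<rho> G) \<phi>"
  let ?f = "\<lambda>y. ln (p t y)"
  have H: "?H \<in> carrier \<G>"
    using G by simp
  have smooth: "smooth_map F A F A (\<rho> G)" "smooth_map F A F A (\<rho> ?H)"
    using action G H by (simp_all add: smooth_action_def)
  have one: "\<rho> \<one>\<^bsub>\<G>\<^esub> u = u"
    and mult: "g \<in> carrier \<G> \<Longrightarrow> h \<in> carrier \<G> \<Longrightarrow> \<rho> (g \<otimes>\<^bsub>\<G>\<^esub> h) u = \<rho> g (\<rho> h u)"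
    if "u \<in> topspace F" for u g h
    using action that by (simp_all add: smooth_action_def)
  have GH: "\<rho> G (\<rho> ?H u) = u" if "u \<in> topspace F" for u
    using mult[OF that G H] one[OF that] G by simp
  have HG: "\<rho> ?H (\<rho> G u) = u" if "u \<in> topspace F" for u
    using mult[OF that H G] one[OF that] G by simp
  have y: "\<rho> G \<phi> \<in> topspace F"
    using smooth(1) \<phi> by (auto simp: smooth_map_def dest: continuous_map_image_subset_topspace)
  have "tangent_space A (\<rho> G \<phi>) \<subseteq> ?L ` tangent_space A \<phi>"
  proof
    fix w assume w: "w \<in> tangent_space A (\<rho> G \<phi>)"
    \<comment> \<open>The preimage of \<open>w\<close> is its image under the differential of the
      inverse group element, which is based at \<open>\<phi>\<close> by \<open>HG\<close>.\<close>
    let ?v = "differential A A (\<rho> ?H) (\<rho> G \<phi>) w"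
    have "?L ?v = w"
      using differential_inverse[OF manifold manifold smooth GH y w] HG[OF \<phi>] by simp
    moreover have "?v \<in> tangent_space A \<phi>"
      using differential_in_tangent_space[OF manifold manifold smooth(2) y w] HG[OF \<phi>] by simp
    ultimately show "w \<in> ?L ` tangent_space A \<phi>" by force
  qed
  then have inj: "inj_on (transpose_map A \<phi> ?L) (cotangent_space A (\<rho> G \<phi>))"
    by (rule inj_on_transpose_map)
  have f: "differentiable_fun F A ?f"
    by (rule differentiable_fun_ln[OF manifold differentiable[OF t] positive[OF t]])
  \<comment> \<open>Invariance of \<open>p t\<close> passes to its logarithm, so the dual chain rule
    applies with the same function at both points.\<close>
  have "transpose_map A \<phi> ?L (gradient A ?f (\<rho> G \<phi>)) = gradient A ?f \<phi>"
    using invariant[OF t G]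
    by (intro transpose_differential_gradient[OF manifold manifold smooth(1) f f _ \<phi>]) simp
  \<comment> \<open>Since \<open>inverse_transpose\<close> is \<open>inv_into\<close> on the
    cotangent space, injectivity and membership of the gradient at \<open>\<rho> G \<phi>\<close> in
    that space ensure that exactly this gradient is recovered.\<close>
  then show "score A p (\<rho> G \<phi>) t = inverse_transpose A \<phi> A (\<rho> G \<phi>) ?L (score A p \<phi> t)"
    unfolding score_def inverse_transpose_def
    using inv_into_f_f[OF inj gradient_in_cotangent_space[OF manifold y f]] by simp
qed

end
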